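(* Let $\mathcal F$ be a function space on a finite partially ordered set $\mathfrak T$, and let $\mathcal F(\mathcal T)$ be the corresponding global function space. Assume that we have local extension operators $E^{\mathcal T}_F\colon\mathring{\mathcal F}(F)\to\mathcal F(\mathcal T)$ for every $F\in\mathfrak T$. Then $\mathcal F(\mathcal T)$ is the (internal) direct sum $$\mathcal F(\mathcal T)=\bigoplus_{F\in\mathfrak T}E_F^{\mathcal T}\mathring{\mathcal F}(F).$$
   Context: All vector spaces are over a fixed field. A function space $\mathcal F$ on a partially ordered set $\mathfrak T$ consists of a vector space $\mathcal F(F)$ for every $F\in\mathfrak T$ and a linear map $\operatorname{tr}^F_K\colon\mathcal F(F)\to\mathcal F(K)$ (trace map) for every relation $K\le F$, such that $\operatorname{tr}^F_F$ is the identity and $\operatorname{tr}^G_K\circ\operatorname{tr}^F_G=\operatorname{tr}^F_K$ whenever $K\le G\le F$. The subspace of vanishing trace is $\mathring{\mathcal F}(F)=\{\phi\in\mathcal F(F)\mid\operatorname{tr}^F_K\phi=0\text{ for all }K<F\}$. The global function space is $$\mathcal F(\mathcal T)=\Big\{(\phi_F)_{F\in\mathfrak T}\in\prod_{F\in\mathfrak T}\mathcal F(F)\;\Big|\;\operatorname{tr}^F_K\phi_F=\phi_K\text{ for all }K\le F\Big\}$$ (here $\mathcal T$ is merely a symbol), with $\operatorname{tr}^{\mathcal T}_F\colon\mathcal F(\mathcal T)\to\mathcal F(F)$ the natural projections. For $K\in\mathfrak T$, a local extension operator is a linear map $E^{\mathcal T}_K\colon\mathring{\mathcal F}(K)\to\mathcal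 F(\mathcal T)$ such that $\operatorname{tr}^{\mathcal T}_KE^{\mathcal T}_K\colon\mathring{\mathcal F}(K)\to\mathcal F(K)$ is the inclusion and $\operatorname{tr}^{\mathcal T}_FE^{\mathcal T}_K=0$ for all $F\in\mathfrak T$ with $K\not\le F$. *)

theory Defs
  imports "Jordan_Normal_Form.Missing_VectorSpace"
begin

text \<open>
  The order is given as a relation \<open>r\<close> on the carrier set \<open>T\<close>, where \<open>(K, F) \<in> r\<close> means
  \<open>K \<le> F\<close>. The map \<open>tr F K\<close> is the trace from \<open>F\<close> to \<open>K\<close>. The spaces \<open>V F\<close> share one element
  type, but their carriers and operations are unrelated.
\<close>

locale function_space =
  fixes k :: "('a, 'c) ring_scheme"
    and T :: "'i set"
    and r :: "'i rel"
    and V :: "'i \<Rightarrow> ('a, 'v, 'm) module_scheme"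
    and tr :: "'i \<Rightarrow> 'i \<Rightarrow> 'v \<Rightarrow> 'v"
  assumes field_k: "field k"
    and poset: "partial_order_on T r"
    and space: "F \<in> T \<Longrightarrow> vectorspace k (V F)"
    and trace_linear: "(K, F) \<in> r \<Longrightarrow> linear_map k (V F) (V K) (tr F K)"
    and trace_id: "\<lbrakk>F \<in> T; \<phi> \<in> carrier (V F)\<rbrakk> \<Longrightarrow> tr F F \<phi> = \<phi>"
    and trace_comp: "\<lbrakk>(K, G) \<in> r; (G, F) \<in> r; \<phi> \<in> carrier (V F)\<rbrakk>
                       \<Longrightarrow> tr G K (tr F G \<phi>) = tr F K \<phi>"

definition vanishing_trace ::
    "'i rel \<Rightarrow> ('i \<Rightarrow> ('a, 'v, 'm) module_scheme) \<Rightarrow> ('i \<Rightarrow> 'i \<Rightarrow> 'v \<Rightarrow> 'v) \<Rightarrow> 'i \<Rightarrow> 'v set"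
  where "vanishing_trace r V tr F =
    {\<phi> \<in> carrier (V F). \<forall>K. (K, F) \<in> r \<and> K \<noteq> F \<longrightarrow> tr F K \<phi> = \<zero>\<^bsub>V K\<^esub>}"

text \<open>
  Elements of the product are extensional functions on \<open>T\<close>, so that equality of families is
  equality of functions; the projection to the component \<open>F\<close> is evaluation at \<open>F\<close>. The ring
  fields \<open>mult\<close> and \<open>one\<close> of a module record play no role for modules.
\<close>

definition global_space ::
    "'i set \<Rightarrow> 'i rel \<Rightarrow> ('i \<Rightarrow> ('a, 'v, 'm) module_scheme) \<Rightarrow> ('i \<Rightarrow> 'i \<Rightarrow> 'v \<Rightarrow> 'v)
      \<Rightarrow> ('a, 'i \<Rightarrow> 'v) module"
  where "global_space T r V tr =
    \<lparr>carrier = {\<phi> \<in> \<Pi>\<^sub>E F\<in>T. carrier (V F). \<forall>K F. (K, F) \<in> r \<longrightarrow> tr F K (\<phi> F) = \<phi> K},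
     mult = undefined,
     one = undefined,
     zero = (\<lambda>F\<in>T. \<zero>\<^bsub>V F\<^esub>),
     add = (\<lambda>\<phi> \<psi>. \<lambda>F\<in>T. \<phi> F \<oplus>\<^bsub>V F\<^esub> \<psi> F),
     smult = (\<lambda>a \<phi>. \<lambda>F\<in>T. a \<odot>\<^bsub>V F\<^esub> \<phi> F)\<rparr>"

definition global_trace :: "'i \<Rightarrow> ('i \<Rightarrow> 'v) \<Rightarrow> 'v"
  where "global_trace F \<phi> = \<phi> F"

definition local_extension_operator ::
    "('a, 'c) ring_scheme \<Rightarrow> 'i set \<Rightarrow> 'i rel \<Rightarrow> ('i \<Rightarrow> ('a, 'v, 'm) module_scheme)
      \<Rightarrow> ('i \<Rightarrow> 'i \<Rightarrow> 'v \<Rightarrow> 'v) \<Rightarrow> 'i \<Rightarrow> ('v \<Rightarrow> 'i \<Rightarrow> 'v) \<Rightarrow> bool"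
  where "local_extension_operator k T r V tr K E \<longleftrightarrow>
    linear_map k ((V K)\<lparr>carrier := vanishing_trace r V tr K\<rparr>) (global_space T r V tr) E \<and>
    (\<forall>\<phi> \<in> vanishing_trace r V tr K. global_trace K (E \<phi>) = \<phi>) \<and>
    (\<forall>F \<in> T. (K, F) \<notin> r \<longrightarrow>
      (\<forall>\<phi> \<in> vanishing_trace r V tr K. global_trace F (E \<phi>) = \<zero>\<^bsub>V F\<^esub>))"

text \<open>
  The internal direct sum of a finite family of subspaces; \<open>finite I\<close> is required because
  \<open>finsum\<close> over an infinite index set is zero by convention.
\<close>

definition internal_direct_sum ::
    "('a, 'c) ring_scheme \<Rightarrow> ('a, 'w, 'm) module_scheme \<Rightarrow> 'i set \<Rightarrow> ('i \<Rightarrow> 'w set) \<Rightarrow> bool"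
  where "internal_direct_sum k M I W \<longleftrightarrow>
    finite I \<and>
    (\<forall>i \<in> I. subspace k (W i) M) \<and>
    (\<forall>v \<in> carrier M. \<exists>!w. w \<in> (\<Pi>\<^sub>E i\<in>I. W i) \<and> v = (\<Oplus>\<^bsub>M\<^esub> i\<in>I. w i))"

text \<open>
  The locale predicate \<open>linear_map\<close> also asserts that its domain and codomain are vector spaces.
  The following two facts show that this adds nothing to \<open>local_extension_operator\<close>.
\<close>

lemma (in function_space) vanishing_trace_subspace:
  assumes "F \<in> T"
  shows "subspace k (vanishing_trace r V tr F) (V F)"
proof -
  interpret VF: vectorspace k "V F" using space assms .
  have lin: "linear_map k (V F) (V K) (tr F K)" if "(K, F) \<in> r" for K
    using trace_linear that .
  show ?thesis
  proof (intro subspace.intro submodule.intro)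
    show "vectorspace k (V F)" ..
    show "module k (V F)" ..
    show "vanishing_trace r V tr F \<subseteq> carrier (V F)"
      by (auto simp: vanishing_trace_def)
  next
    fix v w assume "v \<in> vanishing_trace r V tr F" "w \<in> vanishing_trace r V tr F"
    moreover have "tr F K (v \<oplus>\<^bsub>V F\<^esub> w) = \<zero>\<^bsub>V K\<^esub>"
      if "(K, F) \<in> r" "v \<in> carrier (V F)" "w \<in> carrier (V F)"
        "tr F K v = \<zero>\<^bsub>V K\<^esub>" "tr F K w = \<zero>\<^bsub>V K\<^esub>" for K
    proof -
      interpret L: linear_map k "V F" "V K" "tr F K" using lin that(1) .
      show ?thesis using that L.f_add[of v w] by simp
    qed
    ultimately show "v \<oplus>\<^bsub>V F\<^esub> w \<in> vanishing_trace r V tr F"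
      by (auto simp: vanishing_trace_def)
  next
    have "tr F K \<zero>\<^bsub>V F\<^esub> = \<zero>\<^bsub>V K\<^esub>" if "(K, F) \<in> r" for K
    proof -
      interpret L: linear_map k "V F" "V K" "tr F K" using lin that .
      show ?thesis by simp
    qed
    then show "\<zero>\<^bsub>V F\<^esub> \<in> vanishing_trace r V tr F"
      by (auto simp: vanishing_trace_def)
  next
    fix c v assume "c \<in> carrier k" "v \<in> vanishing_trace r V tr F"
    moreover have "tr F K (c \<odot>\<^bsub>V F\<^esub> v) = \<zero>\<^bsub>V K\<^esub>"
      if "(K, F) \<in> r" "c \<in> carrier k" "v \<in> carrier (V F)" "tr F K v = \<zero>\<^bsub>V K\<^esub>" for K
    proof -
      interpret L: linear_map k "V F" "V K" "tr F K" using lin that(1) .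
      show ?thesis using that L.f_smult[of c v] by simp
    qed
    ultimately show "c \<odot>\<^bsub>V F\<^esub> v \<in> vanishing_trace r V tr F"
      by (auto simp: vanishing_trace_def)
  qed
qed

lemma (in function_space) global_space_vectorspace:
  "vectorspace k (global_space T r V tr)"
proof -
  interpret k: field k using field_k .
  have rT: "K \<in> T \<and> F \<in> T" if "(K, F) \<in> r" for K F
    using partial_order_onD(4)[OF poset] that by auto
  have M: "module k (V F)" if "F \<in> T" for F
    using space[OF that] by (simp add: vectorspace_def)
  have A: "abelian_group (V F)" if "F \<in> T" for F
    using M[OF that] by (simp add: module_def)
  note ab = abelian_group.axioms(1)[OF A]
  have closed: "\<phi> F \<in> carrier (V F)" if "\<phi> \<in> carrier (global_space T r V tr)" "F \<in> T" for \<phi> F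
    using that by (auto simp: global_space_def)
  have ext: "\<phi> = \<psi>" if "\<phi> \<in> extensional T" "\<psi> \<in> extensional T" "\<And>F. F \<in> T \<Longrightarrow> \<phi> F = \<psi> F"
    for \<phi> \<psi> :: "'i \<Rightarrow> 'v"
    using that by (rule extensionalityI)
  have extc: "\<phi> \<in> extensional T" if "\<phi> \<in> carrier (global_space T r V tr)" for \<phi>
    using that by (auto simp: global_space_def PiE_def)
  have compat: "tr F K (\<phi> F) = \<phi> K"
    if "\<phi> \<in> carrier (global_space T r V tr)" "(K, F) \<in> r" for \<phi> K F
    using that by (auto simp: global_space_def)
  have hom: "tr F K \<in> module_hom k (V F) (V K)" if "(K, F) \<in> r" for K F
    using trace_linear[OF that] by (auto simp: linear_map_def mod_hom_def mod_hom_axioms_def)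
  have tr0: "tr F K \<zero>\<^bsub>V F\<^esub> = \<zero>\<^bsub>V K\<^esub>" if "(K, F) \<in> r" for K F
  proof -
    interpret L: linear_map k "V F" "V K" "tr F K" using trace_linear[OF that] .
    show ?thesis by simp
  qed
  have carrI: "\<phi> \<in> carrier (global_space T r V tr)"
    if "\<phi> \<in> extensional T" "\<And>F. F \<in> T \<Longrightarrow> \<phi> F \<in> carrier (V F)"
      "\<And>K F. (K, F) \<in> r \<Longrightarrow> tr F K (\<phi> F) = \<phi> K" for \<phi>
    using that by (auto simp: global_space_def PiE_def)
  have zeroe: "\<zero>\<^bsub>global_space T r V tr\<^esub> = (\<lambda>F\<in>T. \<zero>\<^bsub>V F\<^esub>)"
    by (simp add: global_space_def)
  have adde: "\<phi> \<oplus>\<^bsub>global_space T r V tr\<^esub> \<psi> = (\<lambda>F\<in>T. \<phi> F \<oplus>\<^bsub>V F\<^esub> \<psi> F)" for \<phi> \<psi>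
    by (simp add: global_space_def)
  have smulte: "a \<odot>\<^bsub>global_space T r V tr\<^esub> \<phi> = (\<lambda>F\<in>T. a \<odot>\<^bsub>V F\<^esub> \<phi> F)" for a \<phi>
    by (simp add: global_space_def)
  have zeroc: "\<zero>\<^bsub>global_space T r V tr\<^esub> \<in> carrier (global_space T r V tr)"
    by (rule carrI) (auto simp: zeroe tr0 dest: rT intro: abelian_monoid.zero_closed ab)
  have addc: "\<phi> \<oplus>\<^bsub>global_space T r V tr\<^esub> \<psi> \<in> carrier (global_space T r V tr)"
    if "\<phi> \<in> carrier (global_space T r V tr)" "\<psi> \<in> carrier (global_space T r V tr)" for \<phi> \<psi>
    by (rule carrI)
       (use that in \<open>auto simp: adde module_hom_add[OF hom] closed compat dest: rT
          intro: abelian_monoid.a_closed ab\<close>)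
  have smultc: "a \<odot>\<^bsub>global_space T r V tr\<^esub> \<phi> \<in> carrier (global_space T r V tr)"
    if "a \<in> carrier k" "\<phi> \<in> carrier (global_space T r V tr)" for a \<phi>
    by (rule carrI)
       (use that in \<open>auto simp: smulte module_hom_smult[OF hom] closed compat dest: rT
          intro: module.smult_closed[OF M]\<close>)
  have neg: "\<exists>\<psi>\<in>carrier (global_space T r V tr). \<phi> \<oplus>\<^bsub>global_space T r V tr\<^esub> \<psi> = \<zero>\<^bsub>global_space T r V tr\<^esub>"
    if "\<phi> \<in> carrier (global_space T r V tr)" for \<phi>
  proof (rule bexI)
    let ?n = "(\<ominus>\<^bsub>k\<^esub> \<one>\<^bsub>k\<^esub>) \<odot>\<^bsub>global_space T r V tr\<^esub> \<phi>"
    show "?n \<in> carrier (global_space T r V tr)" using that by (intro smultc) auto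
    show "\<phi> \<oplus>\<^bsub>global_space T r V tr\<^esub> ?n = \<zero>\<^bsub>global_space T r V tr\<^esub>"
    proof (rule ext)
      fix F assume F: "F \<in> T"
      interpret VF: module k "V F" using M[OF F] .
      have c: "\<phi> F \<in> carrier (V F)" using closed that F by blast
      show "(\<phi> \<oplus>\<^bsub>global_space T r V tr\<^esub> ?n) F = \<zero>\<^bsub>global_space T r V tr\<^esub> F"
        using F c by (simp add: adde smulte zeroe VF.smult_l_minus VF.M.r_neg)
    qed (auto simp: adde zeroe)
  qed
  show ?thesis
    unfolding vectorspace_def
  proof (intro conjI)
    show "field k" ..
    show "module k (global_space T r V tr)"
    proof (rule module_criteria)
      show "cring k" ..
    qed (auto intro!: ext zeroc addc smultc neg simp: closed extc,
         (auto simp: adde smulte zeroe closed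
            abelian_monoid.a_comm[OF ab] abelian_monoid.a_assoc[OF ab] abelian_monoid.r_zero[OF ab]
            module.smult_assoc1[OF M] module.smult_one[OF M]
            module.smult_l_distr[OF M] module.smult_r_distr[OF M])+)
  qed
qed

end

theory Submission
  imports Defs
begin

text \<open>
  The decomposition is a triangular elimination along the order. The value of a global function
  at a minimal element \<open>F\<close> of its support has vanishing trace, because its traces are the values
  at smaller elements. So this value can be extended globally, and subtracting the extension kills
  the value at \<open>F\<close> and changes values only at elements above \<open>F\<close>. Hence the elimination never
  reintroduces a value that it has already removed, and as the poset is finite, it ends at zero.
  This proves that the summands span (\<open>global_function_decomposition\<close>). To make the induction
  run, the support is replaced by any upward closed set that contains it: removing a minimal
  element keeps the set upward closed, whereas the support itself may grow under subtraction.

  The sum is direct because a summand is recovered from its value at its own index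
  (\<open>extension_range_value\<close>), and the value of a sum at \<open>F\<close> involves only the summands with
  index at most \<open>F\<close>. Two decompositions of the same function therefore agree by well-founded
  induction along the order (\<open>decomposition_unique\<close>).
\<close>

lemma (in mod_hom) hom_finsum:
  assumes "g \<in> A \<rightarrow> carrier M"
  shows "f (\<Oplus>\<^bsub>M\<^esub> i\<in>A. g i) = (\<Oplus>\<^bsub>N\<^esub> i\<in>A. f (g i))"
  using assms
proof (induction A rule: infinite_finite_induct)
  case (insert a A)
  then have "g \<in> A \<rightarrow> carrier M" "g a \<in> carrier M" "(\<lambda>i. f (g i)) \<in> A \<rightarrow> carrier N"
    by auto
  with insert show ?case
    by (simp add: M.M.finsum_insert N.M.finsum_insert M.M.finsum_closed)
qed (simp_all add: M.M.finsum_infinite N.M.finsum_infinite)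

lemma (in function_space) evaluation_mod_hom:
  assumes "F \<in> T"
  shows "mod_hom k (global_space T r V tr) (V F) (\<lambda>\<phi>. \<phi> F)"
proof -
  have "module k (global_space T r V tr)"
    using global_space_vectorspace by (simp add: vectorspace_def)
  moreover have "module k (V F)"
    using space[OF assms] by (simp add: vectorspace_def)
  moreover have "(\<lambda>\<phi>. \<phi> F) \<in> module_hom k (global_space T r V tr) (V F)"
    using assms by (auto simp: module_hom_def global_space_def)
  ultimately show ?thesis
    by (simp add: mod_hom_def mod_hom_axioms_def)
qed

locale extendable_function_space = function_space k T r V tr
  for k :: "('a, 'c) ring_scheme" and T :: "'i set" and r
    and V :: "'i \<Rightarrow> ('a, 'v, 'm) module_scheme" and tr +
  fixes E :: "'i \<Rightarrow> 'v \<Rightarrow> 'i \<Rightarrow> 'v"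
  assumes finite_T: "finite T"
    and extension: "F \<in> T \<Longrightarrow> local_extension_operator k T r V tr F (E F)"
begin

abbreviation "\<G> \<equiv> global_space T r V tr"

abbreviation "\<W> F \<equiv> E F ` vanishing_trace r V tr F"

sublocale \<G>: vectorspace k \<G>
  by (rule global_space_vectorspace)

lemma wf_less: "wf (r - Id)"
proof (rule partial_order_on_well_order_on)
  have "r \<subseteq> T \<times> T"
    using poset by (auto dest: partial_order_onD(4))
  then show "finite r"
    using finite_T by (meson finite_SigmaI finite_subset)
  show "partial_order_on T r"
    by (rule poset)
qed

lemma extension_range_subspace:
  assumes "F \<in> T"
  shows "subspace k (\<W> F) \<G>"
proof -
  interpret E: linear_map k "(V F)\<lparr>carrier := vanishing_trace r V tr F\<rparr>" \<G> "E F"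
    using extension[OF assms] by (simp add: local_extension_operator_def)
  show ?thesis
    using E.imT_is_subspace by (simp add: E.im_def)
qed

lemma extension_range_closed: "F \<in> T \<Longrightarrow> w \<in> \<W> F \<Longrightarrow> w \<in> carrier \<G>"
  using extension_range_subspace[of F]
  by (auto simp: subspace_def submodule_def)

lemma extension_range_value:
  assumes "F \<in> T" "w \<in> \<W> F"
  shows "E F (w F) = w"
  using assms extension[of F]
  by (auto simp: local_extension_operator_def global_trace_def)

lemma extension_range_not_above:
  assumes "F \<in> T" "w \<in> \<W> F" "G \<in> T" "(F, G) \<notin> r"
  shows "w G = \<zero>\<^bsub>V G\<^esub>"
  using assms extension[of F]
  by (auto simp: local_extension_operator_def global_trace_def)

text \<open>
  Let \<open>F\<close> be minimal in \<open>U\<close>. Every element strictly below \<open>F\<close> is outside \<open>U\<close>, where \<open>\<phi>\<close> is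
  zero, so \<open>\<phi> F\<close> has vanishing trace. Its extension lives on the elements above \<open>F\<close>, and these
  are in \<open>U\<close> as \<open>U\<close> is upward closed. So the difference is zero off \<open>U - {F}\<close>, and the induction
  hypothesis applies to it.
\<close>

lemma global_function_decomposition:
  assumes "U \<subseteq> T"
    and "\<And>F G. F \<in> U \<Longrightarrow> (F, G) \<in> r \<Longrightarrow> G \<in> U"
    and "\<phi> \<in> carrier \<G>"
    and "\<And>F. F \<in> T - U \<Longrightarrow> \<phi> F = \<zero>\<^bsub>V F\<^esub>"
  shows "\<exists>w \<in> \<Pi>\<^sub>E F\<in>U. \<W> F. \<phi> = (\<Oplus>\<^bsub>\<G>\<^esub> F\<in>U. w F)"
  using finite_subset[OF assms(1) finite_T] assms
proof (induction U arbitrary: \<phi> rule: finite_psubset_induct)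
  case (psubset U)
  note U = psubset.prems(1) and up = psubset.prems(2) and \<phi> = psubset.prems(3)
    and off_U = psubset.prems(4)
  show ?case
  proof (cases "U = {}")
    case True
    have "\<phi> F = \<zero>\<^bsub>\<G>\<^esub> F" if "F \<in> T" for F
      using that off_U True by (simp add: global_space_def)
    then have "\<phi> = \<zero>\<^bsub>\<G>\<^esub>"
      using \<phi> \<G>.M.zero_closed
      by (intro extensionalityI[of _ T]) (auto simp: global_space_def PiE_def)
    then show ?thesis
      using True by simp
  next
    case False
    then obtain F where F: "F \<in> U" and F_min: "\<And>K. (K, F) \<in> r - Id \<Longrightarrow> K \<notin> U"
      using wfE_min[OF wf_less] by (metis ex_in_conv)
    have FT: "F \<in> T"
      using F U by blast
    have below: "K \<in> T" if "(K, F) \<in> r" for K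
      using that partial_order_onD(4)[OF poset] by auto
    have "\<phi> F \<in> vanishing_trace r V tr F"
      using \<phi> FT F_min below off_U by (auto simp: vanishing_trace_def global_space_def)
    then have e: "E F (\<phi> F) \<in> \<W> F" and e_F: "E F (\<phi> F) F = \<phi> F"
      using extension[OF FT] by (auto simp: local_extension_operator_def global_trace_def)
    have e_closed: "E F (\<phi> F) \<in> carrier \<G>"
      using extension_range_closed[OF FT e] .
    define \<psi> where "\<psi> = \<phi> \<ominus>\<^bsub>\<G>\<^esub> E F (\<phi> F)"
    have \<psi>: "\<psi> \<in> carrier \<G>"
      using \<phi> e_closed by (simp add: \<psi>_def)
    have "\<psi> K = \<zero>\<^bsub>V K\<^esub>" if K: "K \<in> T - (U - {F})" for K
    proof -
      have KT: "K \<in> T"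
        using K by simp
      interpret ev: mod_hom k \<G> "V K" "\<lambda>\<phi>. \<phi> K"
        by (rule evaluation_mod_hom[OF KT])
      have "\<phi> K = E F (\<phi> F) K"
      proof (cases "K = F")
        case False
        then have "(F, K) \<notin> r"
          using K F up by blast
        then show ?thesis
          using False K off_U extension_range_not_above[OF FT e KT] by simp
      qed (simp add: e_F)
      then show ?thesis
        using ev.f_minus[OF \<phi> e_closed] ev.f_im[OF e_closed]
        by (simp add: \<psi>_def ev.N.M.minus_eq ev.N.M.r_neg)
    qed
    moreover have "H \<in> U - {F}" if "G \<in> U - {F}" "(G, H) \<in> r" for G H
      using that up F_min by blast
    ultimately obtain w where w: "w \<in> (\<Pi>\<^sub>E G\<in>U - {F}. \<W> G)"
      and sum_w: "\<psi> = (\<Oplus>\<^bsub>\<G>\<^esub> G\<in>U - {F}. w G)"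
      using psubset.IH[of "U - {F}" \<psi>] F U \<psi> by blast
    let ?w = "w(F := E F (\<phi> F))"
    have insert_F: "insert F (U - {F}) = U"
      using F by blast
    have w_mem: "?w \<in> (\<Pi>\<^sub>E G\<in>U. \<W> G)"
      using PiE_fun_upd[OF e w] insert_F by simp
    then have w_closed: "?w G \<in> carrier \<G>" if "G \<in> U" for G
      using that U extension_range_closed[of G "?w G"] by (auto simp: PiE_def Pi_def)
    have "(\<Oplus>\<^bsub>\<G>\<^esub> G\<in>U - {F}. ?w G) = \<psi>"
      unfolding sum_w
    proof (rule \<G>.M.finsum_cong')
      show "w \<in> U - {F} \<rightarrow> carrier \<G>"
        using w_closed by (metis DiffE Pi_I fun_upd_other singletonI)
    qed auto
    moreover have "?w \<in> U - {F} \<rightarrow> carrier \<G>" "?w F \<in> carrier \<G>"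
      by (rule Pi_I, rule w_closed, simp) (rule w_closed[OF F])
    ultimately have "(\<Oplus>\<^bsub>\<G>\<^esub> G\<in>insert F (U - {F}). ?w G) = ?w F \<oplus>\<^bsub>\<G>\<^esub> \<psi>"
      using \<G>.M.finsum_insert[of "U - {F}" F ?w] psubset.hyps by (simp del: fun_upd_apply)
    then have "(\<Oplus>\<^bsub>\<G>\<^esub> G\<in>U. ?w G) = E F (\<phi> F) \<oplus>\<^bsub>\<G>\<^esub> \<psi>"
      unfolding insert_F fun_upd_same .
    also have "\<dots> = \<phi>"
      unfolding \<psi>_def \<G>.M.minus_eq \<G>.M.a_comm[OF \<phi> \<G>.M.a_inv_closed[OF e_closed]]
      by (rule \<G>.M.r_neg2[OF e_closed \<phi>])
    finally show ?thesis
      by (intro bexI[OF _ w_mem]) (rule sym)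
  qed
qed

text \<open>
  At \<open>F\<close> the summands strictly below \<open>F\<close> agree by induction, and those not below \<open>F\<close> vanish.
  Cancelling all of them from the two sums leaves the values at \<open>F\<close> of the summands for \<open>F\<close>,
  which determine these summands.
\<close>

lemma decomposition_unique:
  assumes w: "w \<in> (\<Pi>\<^sub>E F\<in>T. \<W> F)" and w': "w' \<in> (\<Pi>\<^sub>E F\<in>T. \<W> F)"
    and eq: "(\<Oplus>\<^bsub>\<G>\<^esub> F\<in>T. w F) = (\<Oplus>\<^bsub>\<G>\<^esub> F\<in>T. w' F)"
  shows "w = w'"
proof -
  have mem: "u F \<in> \<W> F" if "u \<in> (\<Pi>\<^sub>E F\<in>T. \<W> F)" "F \<in> T" for u F
    using that by (rule PiE_mem)
  have "F \<in> T \<longrightarrow> w F = w' F" for F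
    using wf_less
  proof (induction F rule: wf_induct_rule)
    case (less F)
    show ?case
    proof
      assume F: "F \<in> T"
      interpret ev: mod_hom k \<G> "V F" "\<lambda>\<phi>. \<phi> F"
        by (rule evaluation_mod_hom[OF F])
      have closed: "u G F \<in> carrier (V F)" if "u \<in> (\<Pi>\<^sub>E F\<in>T. \<W> F)" "G \<in> T" for u G
        using that mem extension_range_closed by (intro ev.f_im) blast
      have split: "(\<Oplus>\<^bsub>\<G>\<^esub> G\<in>T. u G) F = u F F \<oplus>\<^bsub>V F\<^esub> (\<Oplus>\<^bsub>V F\<^esub> G\<in>T - {F}. u G F)"
        if u: "u \<in> (\<Pi>\<^sub>E F\<in>T. \<W> F)" for u
      proof -
        have "u \<in> T \<rightarrow> carrier \<G>"
          using mem[OF u] extension_range_closed by blast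
        then have "(\<Oplus>\<^bsub>\<G>\<^esub> G\<in>T. u G) F = (\<Oplus>\<^bsub>V F\<^esub> G\<in>insert F (T - {F}). u G F)"
          using ev.hom_finsum F by (simp add: insert_absorb)
        also have "\<dots> = u F F \<oplus>\<^bsub>V F\<^esub> (\<Oplus>\<^bsub>V F\<^esub> G\<in>T - {F}. u G F)"
          using finite_T closed[OF u] F by (intro ev.N.M.finsum_insert) auto
        finally show ?thesis .
      qed
      have "w G F = w' G F" if "G \<in> T - {F}" for G
      proof (cases "(G, F) \<in> r")
        case True
        then show ?thesis
          using less that by auto
      next
        case False
        then show ?thesis
          using that F extension_range_not_above[of G "w G" F] mem[OF w, of G]
            extension_range_not_above[of G "w' G" F] mem[OF w', of G] by simp
      qed
      then have "(\<Oplus>\<^bsub>V F\<^esub> G\<in>T - {F}. w G F) = (\<Oplus>\<^bsub>V F\<^esub> G\<in>T - {F}. w' G F)"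
        using closed[OF w'] by (intro ev.N.M.finsum_cong') auto
      moreover have "(\<Oplus>\<^bsub>V F\<^esub> G\<in>T - {F}. w' G F) \<in> carrier (V F)"
        using closed[OF w'] by (intro ev.N.M.finsum_closed) auto
      ultimately have "w F F = w' F F"
        using split[OF w] split[OF w'] eq closed[OF w F] closed[OF w' F]
        by (metis ev.N.M.add.right_cancel)
      then show "w F = w' F"
        using extension_range_value[OF F mem[OF w F]] extension_range_value[OF F mem[OF w' F]]
        by (rule box_equals[OF arg_cong])
    qed
  qed
  then show ?thesis
    using w w' by (intro PiE_ext[of w T \<W> w']) auto
qed

lemma global_space_direct_sum: "internal_direct_sum k \<G> T \<W>"
  unfolding internal_direct_sum_def
proof (intro conjI ballI)
  show "finite T"
    by (rule finite_T)
  show "subspace k (\<W> F) \<G>" if "F \<in> T" for F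
    using that by (rule extension_range_subspace)
  show "\<exists>!w. w \<in> (\<Pi>\<^sub>E F\<in>T. \<W> F) \<and> \<phi> = (\<Oplus>\<^bsub>\<G>\<^esub> F\<in>T. w F)" if \<phi>: "\<phi> \<in> carrier \<G>" for \<phi>
  proof -
    have "\<exists>w \<in> \<Pi>\<^sub>E F\<in>T. \<W> F. \<phi> = (\<Oplus>\<^bsub>\<G>\<^esub> F\<in>T. w F)"
      using \<phi> partial_order_onD(4)[OF poset]
      by (intro global_function_decomposition) auto
    then show ?thesis
      using decomposition_unique by auto
  qed
qed

end

theorem corollary2p14:
  fixes k :: "('a, 'c) ring_scheme"
    and T :: "'i set"
    and r :: "'i rel"
    and V :: "'i \<Rightarrow> ('a, 'v, 'm) module_scheme"
    and tr :: "'i \<Rightarrow> 'i \<Rightarrow> 'v \<Rightarrow> 'v"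
    and E :: "'i \<Rightarrow> 'v \<Rightarrow> 'i \<Rightarrow> 'v"
  assumes "function_space k T r V tr"
    and "finite T"
    and "\<And>F. F \<in> T \<Longrightarrow> local_extension_operator k T r V tr F (E F)"
  shows "internal_direct_sum k (global_space T r V tr) T (\<lambda>F. E F ` vanishing_trace r V tr F)"
proof -
  interpret extendable_function_space k T r V tr E
    using assms by (intro extendable_function_space.intro extendable_function_space_axioms.intro)
  show ?thesis
    by (rule global_space_direct_sum)
qed

end
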